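(* If $G$ is a minimally $1$-tough series–parallel graph, then $G$ is a cycle.
   Context: All graphs are finite and undirected; parallel edges are allowed. For a graph $H$, $c(H)$ denotes its number of components. A set $S\subseteq V(G)$ is a cutset if $c(G-S)>1$. $G$ is $t$-tough if $|S|\ge t\cdot c(G-S)$ for every cutset $S$; the toughness $\tau(G)$ is the largest such $t$, with $\tau(K_n)=\infty$. $G$ is minimally $t$-tough if $\tau(G)=t$ and $\tau(G-e)<t$ for every edge $e$. A series–parallel graph $G(s,t)$ with terminals $s,t$ is either a single edge $st$, or is obtained from series–parallel graphs $G_1(s_1,t_1),\dots,G_k(s_k,t_k)$, $k\ge 2$, by a series join (identify $t_i$ with $s_{i+1}$ for $1\le i\le k-1$, set $s=s_1$, $t=t_k$) or a parallel join (identify all $s_i$ into $s$ and all $t_i$ into $t$). *)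

theory Defs
  imports "HOL-Library.Extended_Real"
begin

text \<open>Values of \<open>ends\<close> outside \<open>edges\<close> are irrelevant.\<close>

record ('v, 'e) mgraph =
  verts :: "'v set"
  edges :: "'e set"
  ends  :: "'e \<Rightarrow> 'v set"

text \<open>Finite undirected graphs; parallel edges are allowed, loops are not.\<close>

locale multigraph =
  fixes G :: "('v, 'e) mgraph"
  assumes finite_verts: "finite (verts G)"
    and finite_edges: "finite (edges G)"
    and ends_in_verts: "e \<in> edges G \<Longrightarrow> ends G e \<subseteq> verts G"
    and card_ends: "e \<in> edges G \<Longrightarrow> card (ends G e) = 2"

definition del_verts :: "('v, 'e) mgraph \<Rightarrow> 'v set \<Rightarrow> ('v, 'e) mgraph" where
  "del_verts G S =
     \<lparr>verts = verts G - S, edges = {e \<in> edges G. ends G e \<inter> S = {}}, ends = ends G\<rparr>"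

definition del_edge :: "('v, 'e) mgraph \<Rightarrow> 'e \<Rightarrow> ('v, 'e) mgraph" where
  "del_edge G e = \<lparr>verts = verts G, edges = edges G - {e}, ends = ends G\<rparr>"

definition adjacent :: "('v, 'e) mgraph \<Rightarrow> 'v \<Rightarrow> 'v \<Rightarrow> bool" where
  "adjacent G u v \<longleftrightarrow> (\<exists>e \<in> edges G. ends G e = {u, v})"

definition connected_rel :: "('v, 'e) mgraph \<Rightarrow> 'v rel" where
  "connected_rel G = {(u, v). u \<in> verts G \<and> v \<in> verts G \<and> (adjacent G)\<^sup>*\<^sup>* u v}"

definition components :: "('v, 'e) mgraph \<Rightarrow> 'v set set" where
  "components G = verts G // connected_rel G"

definition num_components :: "('v, 'e) mgraph \<Rightarrow> nat" where
  "num_components G = card (components G)"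

definition cutset :: "('v, 'e) mgraph \<Rightarrow> 'v set \<Rightarrow> bool" where
  "cutset G S \<longleftrightarrow> S \<subseteq> verts G \<and> num_components (del_verts G S) > 1"

definition tough :: "real \<Rightarrow> ('v, 'e) mgraph \<Rightarrow> bool" where
  "tough t G \<longleftrightarrow>
     (\<forall>S. cutset G S \<longrightarrow> real (card S) \<ge> t * real (num_components (del_verts G S)))"

text \<open>
  A finite graph has finitely many cutsets, so if it has one then the supremum is attained.
  Without cutsets (in particular for complete graphs) every real qualifies and the value
  is \<open>\<infinity>\<close>.
\<close>

definition toughness :: "('v, 'e) mgraph \<Rightarrow> ereal" where
  "toughness G = Sup (ereal ` {t. tough t G})"

definition minimally_tough :: "real \<Rightarrow> ('v, 'e) mgraph \<Rightarrow> bool" where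
  "minimally_tough t G \<longleftrightarrow>
     toughness G = ereal t \<and> (\<forall>e \<in> edges G. toughness (del_edge G e) < ereal t)"

text \<open>\<open>G\<close> is the union of \<open>H 0, \<dots>, H (k - 1)\<close>, no two of which share an edge.\<close>

definition edge_disjoint_union ::
    "('v, 'e) mgraph \<Rightarrow> nat \<Rightarrow> (nat \<Rightarrow> ('v, 'e) mgraph) \<Rightarrow> bool" where
  "edge_disjoint_union G k H \<longleftrightarrow>
     verts G = (\<Union>i<k. verts (H i)) \<and>
     edges G = (\<Union>i<k. edges (H i)) \<and>
     (\<forall>i<k. \<forall>e \<in> edges (H i). ends G e = ends (H i) e) \<and>
     (\<forall>i<k. \<forall>j<k. i \<noteq> j \<longrightarrow> edges (H i) \<inter> edges (H j) = {})"

text \<open>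
  Identification of terminals is expressed by sharing: the parts of a join are subgraphs of
  the result that have exactly the identified terminals in common.  As the two terminals of a
  part are distinct and are never merged, every part embeds into its join, so this loses no
  generality.  In a series join, part \<open>H i\<close> has terminals \<open>x i\<close> and \<open>x (Suc i)\<close>, so that
  \<open>x (Suc i)\<close> is both the second terminal of \<open>H i\<close> and the first one of \<open>H (Suc i)\<close>.
\<close>

inductive series_parallel_terminals :: "('v, 'e) mgraph \<Rightarrow> 'v \<Rightarrow> 'v \<Rightarrow> bool" where
  single_edge:
    "\<lbrakk>s \<noteq> t; verts G = {s, t}; edges G = {e}; ends G e = {s, t}\<rbrakk>
     \<Longrightarrow> series_parallel_terminals G s t"
| series_join:
    "\<lbrakk>k \<ge> 2;
      \<And>i. i < k \<Longrightarrow> series_parallel_terminals (H i) (x i) (x (Suc i));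
      edge_disjoint_union G k H;
      \<And>i. Suc i < k \<Longrightarrow> verts (H i) \<inter> verts (H (Suc i)) = {x (Suc i)};
      \<And>i j. \<lbrakk>Suc i < j; j < k\<rbrakk> \<Longrightarrow> verts (H i) \<inter> verts (H j) = {}\<rbrakk>
     \<Longrightarrow> series_parallel_terminals G (x 0) (x k)"
| parallel_join:
    "\<lbrakk>k \<ge> 2;
      \<And>i. i < k \<Longrightarrow> series_parallel_terminals (H i) s t;
      edge_disjoint_union G k H;
      \<And>i j. \<lbrakk>i < j; j < k\<rbrakk> \<Longrightarrow> verts (H i) \<inter> verts (H j) = {s, t}\<rbrakk>
     \<Longrightarrow> series_parallel_terminals G s t"

definition series_parallel :: "('v, 'e) mgraph \<Rightarrow> bool" where
  "series_parallel G \<longleftrightarrow> (\<exists>s t. series_parallel_terminals G s t)"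

definition is_cycle :: "('v, 'e) mgraph \<Rightarrow> bool" where
  "is_cycle G \<longleftrightarrow>
     (\<exists>n v c. n \<ge> (3::nat) \<and> bij_betw v {..<n} (verts G) \<and> bij_betw c {..<n} (edges G) \<and>
        (\<forall>i<n. ends G (c i) = {v i, v (Suc i mod n)}))"

end

theory Submission
  imports Defs "HOL-Library.Disjoint_Sets"
begin

text \<open>
  In a \<open>1\<close>-tough graph, deleting one vertex leaves one component and deleting two leaves
  at most two. Let \<open>H\<close> be a part of the series-parallel decomposition with terminals \<open>s\<close>
  and \<open>t\<close>. If \<open>H\<close> is a parallel join that misses a vertex of \<open>G\<close>, then only one of its
  constituents can have a vertex besides \<open>s\<close> and \<open>t\<close>, because otherwise \<open>G - {s, t}\<close> would
  have three components. So a Hamiltonian \<open>s\<close>-\<open>t\<close> path of that constituent is one of \<open>H\<close>, while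
  in a series join the paths of the constituents are concatenated. When \<open>H\<close> covers all of \<open>G\<close>,
  two such paths, or one path and an edge between its ends, form a Hamiltonian cycle of \<open>G\<close>.
  As Hamiltonian graphs are \<open>1\<close>-tough, minimality leaves no edge outside that cycle.
\<close>

section \<open>Adjacency and connected components\<close>

lemma adjacent_sym: "adjacent G u v \<Longrightarrow> adjacent G v u"
  by (auto simp: adjacent_def insert_commute)

lemma adjacent_del_verts_iff:
  "adjacent (del_verts G S) u v \<longleftrightarrow> adjacent G u v \<and> u \<notin> S \<and> v \<notin> S"
  by (auto simp: adjacent_def del_verts_def)

lemma equiv_connected_rel: "equiv (verts G) (connected_rel G)"
proof (rule equivI)
  show "refl_on (verts G) (connected_rel G)"
    by (auto simp: refl_on_def connected_rel_def)
  show "sym (connected_rel G)"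
    using sympD[OF symp_rtranclp[OF sympI[OF adjacent_sym]]]
    by (auto simp: connected_rel_def sym_def)
  show "trans (connected_rel G)"
    by (auto simp: trans_def connected_rel_def)
  show "connected_rel G \<subseteq> verts G \<times> verts G"
    by (auto simp: connected_rel_def)
qed

lemma Union_components: "\<Union> (components G) = verts G"
  unfolding components_def by (rule Union_quotient[OF equiv_connected_rel])

lemma finite_components: "finite (verts G) \<Longrightarrow> finite (components G)"
  by (metis Union_components finite_UnionD)

lemma component_adjacent_closed:
  assumes "C \<in> components G" "u \<in> C" "adjacent G u v" "v \<in> verts G"
  shows "v \<in> C"
proof -
  have "u \<in> verts G" using assms(1,2) Union_components[of G] by blast
  then have "(u, v) \<in> connected_rel G"
    using assms(3,4) by (auto simp: connected_rel_def)
  then show ?thesis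
    by (rule in_quotient_imp_closed[OF equiv_connected_rel assms(1)[unfolded components_def] assms(2)])
qed

lemma components_disjoint:
  "C \<in> components G \<Longrightarrow> D \<in> components G \<Longrightarrow> v \<in> C \<Longrightarrow> v \<in> D \<Longrightarrow> C = D"
  unfolding components_def by (drule (1) quotient_disj[OF equiv_connected_rel]) blast

lemma component_nonempty: "C \<in> components G \<Longrightarrow> C \<noteq> {}"
  unfolding components_def by (rule in_quotient_imp_non_empty[OF equiv_connected_rel])

lemma num_components_le_card_verts:
  assumes "finite (verts G)"
  shows "num_components G \<le> card (verts G)"
proof -
  obtain f where f: "\<And>C. C \<in> components G \<Longrightarrow> f C \<in> C"
    using component_nonempty by (metis ex_in_conv)
  have "inj_on f (components G)"
    using f components_disjoint by (metis inj_onI)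
  moreover have "f ` components G \<subseteq> verts G"
    using f Union_components[of G] by auto
  ultimately show ?thesis
    unfolding num_components_def using assms by (rule card_inj_on_le)
qed

section \<open>Lower bounds on the number of components\<close>

text \<open>Such an \<open>A\<close> is a nonempty union of components of \<open>G - S\<close>.
  Disjoint sets of this kind bound the number of components from below without determining any
  component.\<close>

definition closed_off :: "('v, 'e) mgraph \<Rightarrow> 'v set \<Rightarrow> 'v set \<Rightarrow> bool" where
  "closed_off G S A \<longleftrightarrow>
     A \<noteq> {} \<and> A \<subseteq> verts G - S \<and> (\<forall>u \<in> A. \<forall>v. adjacent G u v \<longrightarrow> v \<in> A \<union> S)"

text \<open>Each member of \<open>F\<close> contains the whole component of any of its vertices, and
  disjointness makes the components chosen for different members different.\<close>

lemma card_closed_le_num_components: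
  assumes "finite (verts G)" "disjoint F" "\<And>A. A \<in> F \<Longrightarrow> closed_off G S A"
  shows "card F \<le> num_components (del_verts G S)"
proof -
  let ?D = "del_verts G S"
  have verts: "verts ?D = verts G - S" by (simp add: del_verts_def)
  have "\<exists>C \<in> components ?D. C \<subseteq> A" if "A \<in> F" for A
  proof -
    have A: "closed_off G S A" using assms(3) that .
    then obtain a where a: "a \<in> A" by (auto simp: closed_off_def)
    have "v \<in> A" if "(adjacent ?D)\<^sup>*\<^sup>* a v" for v
      using that
    proof induction
      case base
      show ?case by (rule a)
    next
      case (step y z)
      then show ?case using A unfolding closed_off_def adjacent_del_verts_iff by blast
    qed
    then have "connected_rel ?D `` {a} \<subseteq> A" by (auto simp: connected_rel_def)
    moreover have "connected_rel ?D `` {a} \<in> components ?D"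
      using A a unfolding components_def verts closed_off_def by (auto intro: quotientI)
    ultimately show ?thesis by blast
  qed
  then obtain f where f: "\<And>A. A \<in> F \<Longrightarrow> f A \<in> components ?D \<and> f A \<subseteq> A" by metis
  have "inj_on f F"
  proof (rule inj_onI)
    fix A B assume AB: "A \<in> F" "B \<in> F" "f A = f B"
    then have "f A \<subseteq> A \<inter> B" using f[of A] f[of B] by auto
    moreover have "f A \<noteq> {}" using f AB(1) component_nonempty by blast
    ultimately show "A = B" using disjointD[OF assms(2) AB(1,2)] by blast
  qed
  moreover have "f ` F \<subseteq> components ?D" using f by blast
  moreover have "finite (components ?D)"
    by (rule finite_components) (simp add: verts assms(1))
  ultimately show ?thesis unfolding num_components_def by (rule card_inj_on_le)
qed

text \<open>Toughness says something about cutsets only; the condition \<open>1 < card F\<close>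
  makes \<open>S\<close> one.\<close>

lemma tough_1_card_closed_le:
  assumes "finite (verts G)" "tough 1 G" "S \<subseteq> verts G"
    and "disjoint F" "\<And>A. A \<in> F \<Longrightarrow> closed_off G S A" "1 < card F"
  shows "card F \<le> card S"
proof -
  have le: "card F \<le> num_components (del_verts G S)"
    using card_closed_le_num_components assms(1,4,5) .
  then have "cutset G S" using assms(3,6) by (simp add: cutset_def)
  then show ?thesis using assms(2) le by (force simp: tough_def)
qed

text \<open>This is the absence of cut vertices, the form of toughness used for series
  joins.\<close>

lemma tough_1_two_closed:
  assumes "finite (verts G)" "tough 1 G" "x \<in> verts G"
    and "closed_off G {x} A" "closed_off G {x} B" "A \<inter> B = {}"
  shows False
proof -
  have "A \<noteq> B" using assms(4,6) by (auto simp: closed_off_def)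
  moreover have "disjoint {A, B}" using assms(6) by (auto simp: disjoint_def)
  ultimately show False
    using tough_1_card_closed_le[OF assms(1,2), of "{x}" "{A, B}"] assms by auto
qed

text \<open>The form of toughness used for parallel joins, where \<open>x\<close> and
  \<open>y\<close> are the two terminals.\<close>

lemma tough_1_three_closed:
  assumes "finite (verts G)" "tough 1 G" "x \<in> verts G" "y \<in> verts G"
    and "closed_off G {x, y} A" "closed_off G {x, y} B" "closed_off G {x, y} C"
    and "A \<inter> B = {}" "A \<inter> C = {}" "B \<inter> C = {}"
  shows False
proof -
  have "A \<noteq> B" "A \<noteq> C" "B \<noteq> C" using assms(5-) by (auto simp: closed_off_def)
  then have "card {A, B, C} = 3" by simp
  moreover have "disjoint {A, B, C}"
    using assms(8-) by (auto simp: disjoint_def)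
  moreover have "card {x, y} \<le> 2" by (simp add: card_insert_if)
  ultimately show False
    using tough_1_card_closed_le[OF assms(1,2), of "{x, y}" "{A, B, C}"] assms by auto
qed

section \<open>The supremum \<open>toughness\<close> versus the predicate
  \<open>tough\<close>\<close>

text \<open>The supremum is attained: a cutset violating the bound for \<open>t\<close> keeps every
  admissible \<open>u\<close> at or below a ratio that is smaller than \<open>t\<close>.\<close>

lemma toughness_ge_imp_tough:
  assumes "toughness G \<ge> ereal t"
  shows "tough t G"
  unfolding tough_def
proof (intro allI impI)
  fix S assume S: "cutset G S"
  let ?c = "real (num_components (del_verts G S))"
  have c: "?c > 0" using S by (simp add: cutset_def)
  show "t * ?c \<le> real (card S)"
  proof (rule ccontr)
    assume "\<not> t * ?c \<le> real (card S)"
    then have "real (card S) / ?c < t" using c by (simp add: field_simps)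
    then have "ereal (real (card S) / ?c) < toughness G"
      using assms by (meson less_ereal.simps(1) less_le_trans)
    then obtain u where u: "tough u G" "real (card S) / ?c < u"
      unfolding toughness_def less_Sup_iff by auto
    then have "u * ?c \<le> real (card S)" using S by (simp add: tough_def)
    then show False using u(2) c by (simp add: field_simps)
  qed
qed

lemma tough_imp_toughness_ge: "tough t G \<Longrightarrow> ereal t \<le> toughness G"
  unfolding toughness_def by (rule Sup_upper) simp

lemma toughness_finite_imp_cutset:
  assumes "toughness G = ereal t"
  shows "\<exists>S. cutset G S"
proof (rule ccontr)
  assume "\<nexists>S. cutset G S"
  then have "tough (t + 1) G" by (simp add: tough_def)
  from tough_imp_toughness_ge[OF this] show False using assms by simp
qed

text \<open>A cutset \<open>S\<close> leaves at least two components, so toughness gives two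
  vertices in \<open>S\<close>, and the components give two outside. This leaves room for a cycle of
  length at least three.\<close>

lemma toughness_1_card_verts:
  assumes "finite (verts G)" "toughness G = ereal 1"
  shows "4 \<le> card (verts G)"
proof -
  obtain S where S: "cutset G S" using toughness_finite_imp_cutset assms(2) by blast
  let ?c = "num_components (del_verts G S)"
  have sub: "S \<subseteq> verts G" and c: "1 < ?c" using S by (auto simp: cutset_def)
  have "tough 1 G" using toughness_ge_imp_tough assms(2) by (metis order_refl)
  then have "?c \<le> card S" using S by (simp add: tough_def)
  moreover have "?c \<le> card (verts G - S)"
    using num_components_le_card_verts[of "del_verts G S"] assms(1) by (simp add: del_verts_def)
  moreover have "card (verts G - S) = card (verts G) - card S"
    using sub assms(1) by (meson card_Diff_subset finite_subset)
  ultimately show ?thesis using c by linarith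
qed

section \<open>Hamiltonian paths and cycles\<close>

text \<open>Only the vertex set \<open>V\<close> is that of a part; adjacency is taken in the whole
  graph \<open>G\<close>, so that paths of different parts can be concatenated directly.\<close>

definition ham_path :: "('v, 'e) mgraph \<Rightarrow> 'v set \<Rightarrow> 'v \<Rightarrow> 'v \<Rightarrow> bool" where
  "ham_path G V u v \<longleftrightarrow>
     (\<exists>xs. xs \<noteq> [] \<and> hd xs = u \<and> last xs = v \<and> distinct xs \<and> set xs = V \<and>
           successively (adjacent G) xs)"

definition ham_cycle :: "('v, 'e) mgraph \<Rightarrow> 'v list \<Rightarrow> bool" where
  "ham_cycle G xs \<longleftrightarrow>
     3 \<le> length xs \<and> distinct xs \<and> set xs = verts G \<and>
     successively (adjacent G) xs \<and> adjacent G (last xs) (hd xs)"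

lemma ham_path_edge: "u \<noteq> v \<Longrightarrow> adjacent G u v \<Longrightarrow> ham_path G {u, v} u v"
  unfolding ham_path_def by (intro exI[of _ "[u, v]"]) auto

lemma ham_path_sym:
  assumes "ham_path G V u v"
  shows "ham_path G V v u"
proof -
  obtain xs where "xs \<noteq> []" "hd xs = u" "last xs = v" "distinct xs" "set xs = V"
    "successively (adjacent G) xs"
    using assms by (auto simp: ham_path_def)
  moreover from this have "successively (adjacent G) (rev xs)"
    unfolding successively_rev by (elim successively_mono) (auto intro: adjacent_sym)
  ultimately show ?thesis
    unfolding ham_path_def by (intro exI[of _ "rev xs"]) (auto simp: hd_rev last_rev)
qed

lemma ham_path_join:
  assumes "ham_path G V u v" "ham_path G W v w" "V \<inter> W = {v}"
  shows "ham_path G (V \<union> W) u w"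
proof -
  obtain xs where xs: "xs \<noteq> []" "hd xs = u" "last xs = v" "distinct xs" "set xs = V"
    "successively (adjacent G) xs"
    using assms(1) by (auto simp: ham_path_def)
  obtain ys where ys: "ys \<noteq> []" "hd ys = v" "last ys = w" "distinct ys" "set ys = W"
    "successively (adjacent G) ys"
    using assms(2) by (auto simp: ham_path_def)
  obtain zs where zs: "ys = v # zs" using ys(1,2) by (cases ys) auto
  have "v \<in> V" using xs(1,3,5) by auto
  have "set xs \<inter> set zs = {}" using assms(3) xs(5) ys(4,5) zs by auto
  then have "distinct (xs @ zs)" using xs(4) ys(4) zs by auto
  moreover have "successively (adjacent G) (xs @ zs)"
    using xs ys(6) zs by (cases zs) (auto simp: successively_append_iff)
  moreover have "set (xs @ zs) = V \<union> W" using xs(5) ys(5) zs \<open>v \<in> V\<close> by auto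
  moreover have "hd (xs @ zs) = u" "last (xs @ zs) = w" using xs(1-3) ys(3) zs by auto
  ultimately show ?thesis unfolding ham_path_def using xs(1) by (intro exI[of _ "xs @ zs"]) auto
qed

lemma ham_path_imp_ham_cycle:
  assumes "ham_path G (verts G) u v" "adjacent G v u" "3 \<le> card (verts G)"
  shows "\<exists>xs. ham_cycle G xs"
  using assms unfolding ham_path_def ham_cycle_def by (metis distinct_card)

text \<open>Without its first vertex \<open>u\<close>, the first path meets the second only in
  \<open>v\<close>. Joined to the reversed second path it runs from the neighbour \<open>a\<close>
  of \<open>u\<close> back to \<open>u\<close>, and the edge between \<open>u\<close> and
  \<open>a\<close> closes the cycle.\<close>

lemma two_ham_paths_imp_ham_cycle:
  assumes "ham_path G V u v" "ham_path G W u v" "V \<inter> W = {u, v}" "u \<noteq> v"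
    and "V \<union> W = verts G" "3 \<le> card (verts G)"
  shows "\<exists>xs. ham_cycle G xs"
proof -
  obtain xs where xs: "xs \<noteq> []" "hd xs = u" "last xs = v" "distinct xs" "set xs = V"
    "successively (adjacent G) xs"
    using assms(1) by (auto simp: ham_path_def)
  obtain a ys where ys: "xs = u # a # ys"
    using xs(1-3) assms(4) by (metis last.simps list.collapse)
  have "ham_path G (V - {u}) a v"
    unfolding ham_path_def by (intro exI[of _ "a # ys"]) (use xs ys in auto)
  moreover have "(V - {u}) \<inter> W = {v}" using assms(3,4) by auto
  ultimately have "ham_path G (V - {u} \<union> W) a u"
    using ham_path_join ham_path_sym[OF assms(2)] by metis
  moreover have "V - {u} \<union> W = verts G" using assms(3,5) by auto
  moreover have "adjacent G u a" using xs(6) ys by simp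
  ultimately show ?thesis using ham_path_imp_ham_cycle assms(6) by metis
qed

section \<open>Hamiltonian graphs are 1-tough\<close>

text \<open>The index \<open>i\<close> is unbounded so that a walk may run past the end of the list
  and wrap around.\<close>

lemma ham_cycle_adjacent_nth:
  assumes "ham_cycle G xs"
  shows "adjacent G (xs ! (i mod length xs)) (xs ! (Suc i mod length xs))"
proof -
  let ?n = "length xs"
  have n: "3 \<le> ?n" using assms by (simp add: ham_cycle_def)
  have suc: "Suc i mod ?n = Suc (i mod ?n) mod ?n" by (simp add: mod_Suc_eq)
  have "i mod ?n < ?n" using n by (intro mod_less_divisor) auto
  then consider "Suc (i mod ?n) < ?n" | "Suc (i mod ?n) = ?n" by linarith
  then show ?thesis
  proof cases
    case 1
    then show ?thesis
      using assms suc by (simp add: ham_cycle_def successively_conv_nth)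
  next
    case 2
    have "xs \<noteq> []" using n by auto
    moreover have "i mod ?n = ?n - 1" using 2 by simp
    ultimately show ?thesis
      using assms suc 2 by (simp add: ham_cycle_def last_conv_nth hd_conv_nth)
  qed
qed

text \<open>
  Walking around the cycle, every component of \<open>G - S\<close> is left through a vertex of \<open>S\<close>,
  and different components are left through different vertices.
\<close>

lemma ham_cycle_imp_tough_1:
  assumes "finite (verts G)" "ham_cycle G xs"
  shows "tough 1 G"
  unfolding tough_def
proof (intro allI impI)
  fix S assume S: "cutset G S"
  let ?D = "del_verts G S" and ?n = "length xs"
  let ?x = "\<lambda>i. xs ! (i mod ?n)"
  have n: "3 \<le> ?n" "distinct xs" "set xs = verts G" using assms(2) by (auto simp: ham_cycle_def)
  then have npos: "0 < ?n" by linarith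
  have verts: "verts ?D = verts G - S" by (simp add: del_verts_def)
  have finS: "finite S" using S assms(1) by (auto simp: cutset_def intro: finite_subset)
  have xin: "?x i \<in> verts G" for i using n(3) npos by (metis mod_less_divisor nth_mem)
  have "\<exists>i. ?x i \<in> C \<and> ?x (Suc i) \<in> S" if C: "C \<in> components ?D" for C
  \<comment> \<open>Otherwise \<open>C\<close> is closed under passing to the next vertex of the
    cycle, hence contains every vertex of \<open>G\<close>, and \<open>G - S\<close> has no second
    component.\<close>
  proof (rule ccontr)
    assume none: "\<nexists>i. ?x i \<in> C \<and> ?x (Suc i) \<in> S"
    have step: "?x (Suc i) \<in> C" if i: "?x i \<in> C" for i
    proof (rule component_adjacent_closed[OF C i])
      have "?x (Suc i) \<notin> S" using none i by blast
      moreover have "?x i \<notin> S" using C i Union_components[of ?D] verts by blast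
      ultimately show "adjacent ?D (?x i) (?x (Suc i))" "?x (Suc i) \<in> verts ?D"
        using ham_cycle_adjacent_nth[OF assms(2)] xin[of "Suc i"]
        by (auto simp: adjacent_del_verts_iff verts)
    qed
    obtain a where a: "a \<in> C" using component_nonempty[OF C] by blast
    then have "a \<in> set xs" using C Union_components[of ?D] verts n(3) by blast
    then obtain i where i: "i < ?n" "xs ! i = a" by (auto simp: in_set_conv_nth)
    have walk: "?x (i + m) \<in> C" for m
      by (induction m) (use i a step in auto)
    have "v \<in> C" if "v \<in> verts G" for v
    proof -
      obtain j where j: "j < ?n" "xs ! j = v" using \<open>v \<in> verts G\<close> n(3) by (metis in_set_conv_nth)
      \<comment> \<open>Adding \<open>?n\<close> keeps the subtraction of naturals from being cut
        off when \<open>j < i\<close>.\<close>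
      have "(i + (j + ?n - i)) mod ?n = j" using i(1) j(1) by simp
      then show ?thesis using walk[of "j + ?n - i"] j(2) by simp
    qed
    then have "components ?D \<subseteq> {C}"
      using components_disjoint[OF C] component_nonempty Union_components[of ?D] verts by blast
    then have "num_components ?D \<le> 1"
      unfolding num_components_def using card_mono[of "{C}"] by simp
    then show False using S by (simp add: cutset_def)
  qed
  then obtain f where f: "\<And>C. C \<in> components ?D \<Longrightarrow> ?x (f C) \<in> C \<and> ?x (Suc (f C)) \<in> S"
    by metis
  have "inj_on (\<lambda>C. ?x (Suc (f C))) (components ?D)"
  proof (rule inj_onI)
    fix C D assume CD: "C \<in> components ?D" "D \<in> components ?D" "?x (Suc (f C)) = ?x (Suc (f D))"
    then have "Suc (f C) mod ?n = Suc (f D) mod ?n"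
      using n(2) npos by (simp add: nth_eq_iff_index_eq)
    then have "f C mod ?n = f D mod ?n"
      by (simp add: mod_Suc split: if_splits)
    then show "C = D" using f CD components_disjoint by metis
  qed
  moreover have "(\<lambda>C. ?x (Suc (f C))) ` components ?D \<subseteq> S" using f by blast
  ultimately have "num_components ?D \<le> card S"
    unfolding num_components_def using finS by (rule card_inj_on_le)
  then show "1 * real (num_components ?D) \<le> real (card S)" by simp
qed

section \<open>Terminals and overlaps in series-parallel graphs\<close>

lemma series_parallel_terminals_in_verts:
  "series_parallel_terminals H s t \<Longrightarrow> s \<in> verts H \<and> t \<in> verts H"
proof (induction rule: series_parallel_terminals.induct)
  case (series_join k H x G)
  have "x 0 \<in> verts (H 0)" using series_join.IH[of 0] series_join.hyps(1) by simp
  moreover have "x k \<in> verts (H (k - 1))"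
    using series_join.IH[of "k - 1"] series_join.hyps(1) by simp
  ultimately show ?case
    using series_join.hyps by (force simp: edge_disjoint_union_def)
next
  case (parallel_join k H s t G)
  then have "s \<in> verts (H 0)" "t \<in> verts (H 0)" by auto
  then show ?case using parallel_join.hyps by (force simp: edge_disjoint_union_def)
qed simp

text \<open>Only neighbouring parts meet, and their common vertex is a terminal of both. This
  supplies the overlap condition of \<open>attached_part\<close>.\<close>

lemma series_part_overlap:
  assumes "\<And>i. Suc i < k \<Longrightarrow> verts (H i) \<inter> verts (H (Suc i)) = {x (Suc i)}"
    and "\<And>i j. \<lbrakk>Suc i < j; j < k\<rbrakk> \<Longrightarrow> verts (H i) \<inter> verts (H j) = {}"
    and "i < k" "j < k" "i \<noteq> j"
  shows "verts (H i) \<inter> verts (H j) \<subseteq> {x i, x (Suc i)}"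
proof -
  consider "Suc i < j" | "j = Suc i" | "i = Suc j" | "Suc j < i" using assms(5) by linarith
  then show ?thesis
  proof cases
    case 1 then show ?thesis using assms(2)[of i j] assms(4) by simp
  next
    case 2 then show ?thesis using assms(1)[of i] assms(4) by simp
  next
    case 3 then show ?thesis using assms(1)[of j] assms(3) by auto
  next
    case 4 then show ?thesis using assms(2)[of j i] assms(3) by auto
  qed
qed

text \<open>In a series join, \<open>x 0\<close> lies in the first part and \<open>x k\<close> in
  the last. For more than two parts these are disjoint; for two they share only \<open>x 1\<close>,
  which differs from \<open>x 0\<close> by induction.\<close>

lemma series_parallel_terminals_distinct:
  "series_parallel_terminals H s t \<Longrightarrow> s \<noteq> t"
proof (induction rule: series_parallel_terminals.induct)
  case (series_join k H x G)
  have first: "x 0 \<in> verts (H 0)" "x 0 \<noteq> x 1"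
    using series_join.IH[of 0] series_join.hyps(1)
      series_parallel_terminals_in_verts[OF series_join.hyps(2)[of 0]] by auto
  have last: "x k \<in> verts (H (k - 1))"
    using series_join.hyps(1)
      series_parallel_terminals_in_verts[OF series_join.hyps(2)[of "k - 1"]] by auto
  show ?case
  proof (cases "k = 2")
    case True
    then have "verts (H 0) \<inter> verts (H 1) = {x 1}" "x k \<in> verts (H 1)"
      using series_join.hyps(4)[of 0] last True by simp_all
    then show ?thesis using first by (metis IntI singletonD)
  next
    case False
    then have "verts (H 0) \<inter> verts (H (k - 1)) = {}"
      using series_join.hyps(1) series_join.hyps(5)[of 0 "k - 1"] by simp
    then show ?thesis using first last by auto
  qed
next
  case (parallel_join k H s t G)
  then show ?case by (metis less_le_trans pos2)
qed

lemma series_parallel_terminals_ends_subset: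
  "series_parallel_terminals H s t \<Longrightarrow> e \<in> edges H \<Longrightarrow> ends H e \<subseteq> verts H"
proof (induction arbitrary: e rule: series_parallel_terminals.induct)
  case (series_join k H x G)
  then show ?case by (fastforce simp: edge_disjoint_union_def)
next
  case (parallel_join k H s t G)
  then show ?case by (fastforce simp: edge_disjoint_union_def)
qed auto

section \<open>Parts meeting the rest of the graph only in their terminals\<close>

text \<open>
  \<open>G\<close> may contain edges between \<open>s\<close> and \<open>t\<close>, or from \<open>s\<close> and \<open>t\<close> to the outside, that are
  not in \<open>H\<close>.
\<close>

definition attached ::
    "('v, 'e) mgraph \<Rightarrow> ('v, 'e) mgraph \<Rightarrow> 'v \<Rightarrow> 'v \<Rightarrow> bool" where
  "attached G H s t \<longleftrightarrow>
     verts H \<subseteq> verts G \<and> edges H \<subseteq> edges G \<and> (\<forall>e \<in> edges H. ends H e = ends G e) \<and>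
     (\<forall>e \<in> edges H. ends H e \<subseteq> verts H) \<and>
     (\<forall>e \<in> edges G. ends G e \<inter> (verts H - {s, t}) \<noteq> {} \<longrightarrow> e \<in> edges H)"

text \<open>A vertex of \<open>P i\<close> other than \<open>a\<close> and \<open>b\<close> is no
  terminal of \<open>H\<close> and lies in no other part. So an edge of \<open>G\<close> at it
  belongs to \<open>H\<close>, and within \<open>H\<close> to \<open>P i\<close>. Both kinds of join
  satisfy the overlap conditions.\<close>

lemma attached_part:
  assumes "attached G H s t" "edge_disjoint_union H k P" "i < k"
    and "\<And>j e. j < k \<Longrightarrow> e \<in> edges (P j) \<Longrightarrow> ends (P j) e \<subseteq> verts (P j)"
    and "\<And>j. j < k \<Longrightarrow> i \<noteq> j \<Longrightarrow> verts (P i) \<inter> verts (P j) \<subseteq> {a, b}"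
    and "verts (P i) \<inter> {s, t} \<subseteq> {a, b}"
  shows "attached G (P i) a b"
  unfolding attached_def
proof (intro conjI ballI impI)
  show "verts (P i) \<subseteq> verts G" "edges (P i) \<subseteq> edges G"
    using assms(1-3) by (auto simp: attached_def edge_disjoint_union_def)
  have ends: "ends (P j) e = ends G e" if "j < k" "e \<in> edges (P j)" for j e
    using assms(1,2) that unfolding attached_def edge_disjoint_union_def by (metis UN_I lessThan_iff)
  show "ends (P i) e = ends G e" if "e \<in> edges (P i)" for e
    using ends assms(3) that .
  show "ends (P i) e \<subseteq> verts (P i)" if "e \<in> edges (P i)" for e
    using assms(3,4) that by blast
  fix e assume e: "e \<in> edges G" "ends G e \<inter> (verts (P i) - {a, b}) \<noteq> {}"
  then obtain v where v: "v \<in> ends G e" "v \<in> verts (P i)" "v \<notin> {a, b}" by blast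
  have "v \<in> verts H - {s, t}"
    using v assms(2,3,6) by (auto simp: edge_disjoint_union_def)
  then have "e \<in> edges H" using e(1) v(1) assms(1) by (auto simp: attached_def)
  then obtain j where j: "j < k" "e \<in> edges (P j)"
    using assms(2) by (auto simp: edge_disjoint_union_def)
  then have "v \<in> verts (P j)" using assms(4) ends v(1) by blast
  then have "i = j" using assms(5)[OF j(1)] v by blast
  then show "e \<in> edges (P i)" using j by simp
qed

lemma attached_interior_closed_off:
  assumes "attached G H s t" "verts H - {s, t} \<noteq> {}"
  shows "closed_off G {s, t} (verts H - {s, t})"
  unfolding closed_off_def
proof (intro conjI ballI allI impI)
  show "verts H - {s, t} \<subseteq> verts G - {s, t}" using assms(1) by (auto simp: attached_def)
  fix u v assume u: "u \<in> verts H - {s, t}" and "adjacent G u v"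
  then obtain e where e: "e \<in> edges G" "ends G e = {u, v}" by (auto simp: adjacent_def)
  then have "e \<in> edges H" using u assms(1) by (auto simp: attached_def)
  then show "v \<in> verts H - {s, t} \<union> {s, t}" using e(2) assms(1) by (fastforce simp: attached_def)
qed (rule assms(2))

text \<open>An edge from outside \<open>H\<close> to an inner vertex of \<open>H\<close> would be an
  edge of \<open>H\<close> and so have both ends in \<open>H\<close>.\<close>

lemma attached_exterior_closed_off:
  assumes "multigraph G" "attached G H s t" "s \<in> verts H" "t \<in> verts H" "verts H \<noteq> verts G"
  shows "closed_off G {s, t} (verts G - verts H)"
  unfolding closed_off_def
proof (intro conjI ballI allI impI)
  show "verts G - verts H \<noteq> {}" using assms(2,5) by (auto simp: attached_def)
  show "verts G - verts H \<subseteq> verts G - {s, t}" using assms(3,4) by auto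
  fix u v assume u: "u \<in> verts G - verts H" and "adjacent G u v"
  then obtain e where e: "e \<in> edges G" "ends G e = {u, v}" by (auto simp: adjacent_def)
  then have "v \<in> verts G" using multigraph.ends_in_verts[OF assms(1) e(1)] by simp
  moreover have "v \<notin> verts H - {s, t}"
  proof
    assume "v \<in> verts H - {s, t}"
    then have "e \<in> edges H" using e assms(2) by (auto simp: attached_def)
    then show False using e(2) u assms(2) by (fastforce simp: attached_def)
  qed
  ultimately show "v \<in> verts G - verts H \<union> {s, t}" by blast
qed

section \<open>Induction over the series-parallel decomposition\<close>

text \<open>
  Exactly one constituent may have inner vertices even when \<open>H\<close> covers \<open>G\<close>; it then covers \<open>G\<close>
  itself, so the cycle case of the induction hypothesis applies. This is why the dichotomy is
  stated by comparing vertex sets only.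
\<close>

lemma ham_path_or_ham_cycle_parallel:
  assumes G: "multigraph G" "tough 1 G" "3 \<le> card (verts G)"
    and H: "attached G H s t"
    and k: "2 \<le> k"
    and sp: "\<And>i. i < k \<Longrightarrow> series_parallel_terminals (P i) s t"
    and IH: "\<And>i. i < k \<Longrightarrow> attached G (P i) s t \<Longrightarrow>
      (if verts (P i) = verts G then \<exists>xs. ham_cycle G xs else ham_path G (verts (P i)) s t)"
    and un: "edge_disjoint_union H k P"
    and disj: "\<And>i j. \<lbrakk>i < j; j < k\<rbrakk> \<Longrightarrow> verts (P i) \<inter> verts (P j) = {s, t}"
  shows "if verts H = verts G then \<exists>xs. ham_cycle G xs else ham_path G (verts H) s t"
proof -
  have finG: "finite (verts G)" using G(1) by (rule multigraph.finite_verts)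
  have st: "s \<noteq> t" using series_parallel_terminals_distinct[OF sp[of 0]] k by simp
  have stP: "s \<in> verts (P i)" "t \<in> verts (P i)" if "i < k" for i
    using series_parallel_terminals_in_verts[OF sp[OF that]] by auto
  have vH: "verts H = (\<Union>i<k. verts (P i))" using un by (simp add: edge_disjoint_union_def)
  then have stH: "s \<in> verts H" "t \<in> verts H" using stP[of 0] k by force+
  have stG: "s \<in> verts G" "t \<in> verts G" using stH H by (auto simp: attached_def)
  have PH: "verts (P i) \<subseteq> verts H" if "i < k" for i using vH that by blast
  have HG: "verts H \<subseteq> verts G" using H by (simp add: attached_def)
  have disj': "verts (P i) \<inter> verts (P j) = {s, t}" if "i < k" "j < k" "i \<noteq> j" for i j
    using disj that by (metis Int_commute linorder_neqE_nat)
  have att: "attached G (P i) s t" if "i < k" for i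
    using attached_part[OF H un that] sp series_parallel_terminals_ends_subset disj' that
    by (metis Int_lower2 subset_refl)
  \<comment> \<open>\<open>N\<close> collects the constituents with inner vertices; the cases are
    none, exactly one, and at least two.\<close>
  define N where "N = {i. i < k \<and> verts (P i) - {s, t} \<noteq> {}}"
  have triv: "verts (P i) = {s, t}" if "i < k" "i \<notin> N" for i
    using stP[OF that(1)] that by (auto simp: N_def)
  have cl: "closed_off G {s, t} (verts (P i) - {s, t})" if "i \<in> N" for i
    using attached_interior_closed_off[OF att] that by (simp add: N_def)
  consider "N = {}" | i where "N = {i}" | i j where "i \<in> N" "j \<in> N" "i \<noteq> j" by blast
  then show ?thesis
  proof cases
    \<comment> \<open>Every constituent then has the vertex set of \<open>H\<close>, so the path of
      any one of them serves, for instance that of \<open>P 0\<close>.\<close>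
    case 1
    have "card {s, t} \<le> 2" by (simp add: card_insert_if)
    then have ne: "{s, t} \<noteq> verts G" using G(3) by auto
    have 0: "verts (P 0) = {s, t}" using triv 1 k by simp
    have "verts H \<subseteq> {s, t}" unfolding vH using triv 1 by (intro UN_least) simp
    then have "verts H = {s, t}" using stH by blast
    then show ?thesis using IH[of 0] att[of 0] k ne 0 by simp
  next
    case (2 i)
    then have i: "i < k" by (auto simp: N_def)
    have "verts (P j) \<subseteq> verts (P i)" if "j < k" for j
      using triv[of j] stP[OF i] that 2 by (cases "j = i") auto
    then have "verts H = verts (P i)" using vH i by blast
    then show ?thesis using IH att i by simp
  next
    case (3 i j)
    then have ij: "i < k" "j < k" by (auto simp: N_def)
    have meet: "verts (P i) \<inter> verts (P j) = {s, t}" using disj' ij 3 by simp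
    obtain a b where "a \<in> verts (P i) - {s, t}" "b \<in> verts (P j) - {s, t}"
      using 3(1,2) by (auto simp: N_def)
    then have ne: "verts (P i) \<noteq> verts G" "verts (P j) \<noteq> verts G"
      using meet PH[OF ij(1)] PH[OF ij(2)] HG by blast+
    \<comment> \<open>Two interiors and a nonempty exterior would be three separate pieces of
      \<open>G - {s, t}\<close>. The same count then excludes a third interior.\<close>
    have HeqG: "verts H = verts G"
    proof (rule ccontr)
      assume "verts H \<noteq> verts G"
      then show False
        using tough_1_three_closed[OF finG G(2) stG cl[OF 3(1)] cl[OF 3(2)]
          attached_exterior_closed_off[OF G(1) H stH]] meet PH ij by blast
    qed
    have "m = i \<or> m = j" if "m \<in> N" for m
    proof (rule ccontr)
      assume m: "\<not> (m = i \<or> m = j)"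
      have "m < k" using that by (simp add: N_def)
      then show False
        using tough_1_three_closed[OF finG G(2) stG cl[OF 3(1)] cl[OF 3(2)] cl[OF that]]
          meet disj'[of i m] disj'[of j m] m ij by blast
    qed
    then have "verts (P m) \<subseteq> verts (P i) \<union> verts (P j)" if "m < k" for m
      using triv[OF that] stP[OF ij(1)] by (cases "m \<in> N") auto
    then have "verts H = verts (P i) \<union> verts (P j)" using vH ij by blast
    moreover have "ham_path G (verts (P i)) s t" "ham_path G (verts (P j)) s t"
      using IH att ij ne by simp_all
    ultimately have "\<exists>xs. ham_cycle G xs"
      using two_ham_paths_imp_ham_cycle[OF _ _ meet st _ G(3)] HeqG by metis
    then show ?thesis using HeqG by simp
  qed
qed

text \<open>No part covers \<open>G\<close>, so induction provides a path for each, and their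
  concatenation is a Hamiltonian path of \<open>H\<close>. If \<open>H\<close> covers
  \<open>G\<close>, the ends of this path are adjacent, since otherwise \<open>x 1\<close> would be
  a cut vertex separating the first part from the rest.\<close>

lemma ham_path_or_ham_cycle_series:
  assumes G: "multigraph G" "tough 1 G" "3 \<le> card (verts G)"
    and H: "attached G H (x 0) (x k)"
    and k: "2 \<le> k"
    and sp: "\<And>i. i < k \<Longrightarrow> series_parallel_terminals (P i) (x i) (x (Suc i))"
    and IH: "\<And>i. i < k \<Longrightarrow> attached G (P i) (x i) (x (Suc i)) \<Longrightarrow>
      (if verts (P i) = verts G then \<exists>xs. ham_cycle G xs
       else ham_path G (verts (P i)) (x i) (x (Suc i)))"
    and un: "edge_disjoint_union H k P"
    and con: "\<And>i. Suc i < k \<Longrightarrow> verts (P i) \<inter> verts (P (Suc i)) = {x (Suc i)}"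
    and disj: "\<And>i j. \<lbrakk>Suc i < j; j < k\<rbrakk> \<Longrightarrow> verts (P i) \<inter> verts (P j) = {}"
  shows "if verts H = verts G then \<exists>xs. ham_cycle G xs else ham_path G (verts H) (x 0) (x k)"
proof -
  have finG: "finite (verts G)" using G(1) by (rule multigraph.finite_verts)
  have k0: "0 < k" "1 < k" using k by auto
  have xP: "x i \<in> verts (P i)" "x (Suc i) \<in> verts (P i)" if "i < k" for i
    using series_parallel_terminals_in_verts[OF sp[OF that]] by auto
  have xne: "x i \<noteq> x (Suc i)" if "i < k" for i
    using series_parallel_terminals_distinct[OF sp[OF that]] .
  have xk: "x k \<in> verts (P (k - 1))" using xP(2)[of "k - 1"] k by simp
  have over: "verts (P i) \<inter> verts (P j) \<subseteq> {x i, x (Suc i)}" if "i < k" "j < k" "i \<noteq> j" for i j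
    using series_part_overlap[where H = P, OF con disj that] .
  have meet0: "verts (P 0) \<inter> verts (P j) \<subseteq> {x 1}" if "j < k" "j \<noteq> 0" for j
    using con[of 0] disj[of 0 j] that by (cases "j = 1") auto
  have vH: "verts H = (\<Union>i<k. verts (P i))" using un by (simp add: edge_disjoint_union_def)
  have HG: "verts H \<subseteq> verts G" using H by (simp add: attached_def)
  have PG: "verts (P i) \<subseteq> verts G" if "i < k" for i using vH HG that by blast
  have ends: "ends (P i) e \<subseteq> verts (P i)" if "i < k" "e \<in> edges (P i)" for i e
    using series_parallel_terminals_ends_subset[OF sp[OF that(1)] that(2)] .
  \<comment> \<open>\<open>x 2\<close> witnesses that there are vertices outside the first
    part.\<close>
  have x2: "x 2 \<in> verts (P 1)" "x 2 \<notin> verts (P 0)"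
  proof -
    show "x 2 \<in> verts (P 1)" using xP(2)[OF k0(2)] by (simp add: numeral_2_eq_2)
    then show "x 2 \<notin> verts (P 0)"
      using meet0[OF k0(2)] xne[OF k0(2)] by (auto simp: numeral_2_eq_2)
  qed
  have terms: "verts (P i) \<inter> {x 0, x k} \<subseteq> {x i, x (Suc i)}" if "i < k" for i
  proof -
    have "x 0 \<in> {x i, x (Suc i)}" if "x 0 \<in> verts (P i)"
      using over[OF \<open>i < k\<close> k0(1)] xP(1)[OF k0(1)] that by (cases "i = 0") auto
    moreover have "x k \<in> {x i, x (Suc i)}" if "x k \<in> verts (P i)"
      using over[OF \<open>i < k\<close>, of "k - 1"] xk that k0 by (cases "i = k - 1") auto
    ultimately show ?thesis by auto
  qed
  have att: "attached G (P i) (x i) (x (Suc i))" if "i < k" for i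
    using attached_part[OF H un that ends over[OF that] terms[OF that]] by blast
  \<comment> \<open>The first part misses \<open>x 2\<close>, every later one misses
    \<open>x 0\<close>.\<close>
  have ne: "verts (P i) \<noteq> verts G" if "i < k" for i
  proof (cases "i = 0")
    case True
    then show ?thesis using x2 PG[OF k0(2)] by auto
  next
    case False
    then have "x 0 \<notin> verts (P i)"
      using meet0[OF that] xP(1)[OF k0(1)] xne[OF k0(1)] by auto
    then show ?thesis using PG[OF k0(1)] xP(1)[OF k0(1)] by auto
  qed
  have paths: "ham_path G (verts (P i)) (x i) (x (Suc i))" if "i < k" for i
    using IH att ne that by simp
  \<comment> \<open>Parts are appended one at a time; among the earlier ones only \<open>P m\<close>
    meets \<open>P (Suc m)\<close>.\<close>
  have "ham_path G (\<Union>i<Suc m. verts (P i)) (x 0) (x (Suc m))" if "Suc m \<le> k" for m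
    using that
  proof (induction m)
    case 0
    then show ?case using paths[of 0] by (simp add: lessThan_Suc)
  next
    case (Suc m)
    have "(\<Union>i<Suc m. verts (P i)) \<inter> verts (P (Suc m)) = {x (Suc m)}"
    proof -
      have "verts (P i) \<inter> verts (P (Suc m)) = {}" if "i < m" for i
        using disj that Suc.prems by simp
      moreover have "verts (P m) \<inter> verts (P (Suc m)) = {x (Suc m)}" using con Suc.prems by simp
      ultimately show ?thesis by (auto simp: lessThan_Suc)
    qed
    from ham_path_join[OF Suc.IH paths this] Suc.prems
    show ?case by (simp add: lessThan_Suc Un_commute Un_left_commute)
  qed
  from this[of "k - 1"] have path: "ham_path G (verts H) (x 0) (x k)"
    using k0 vH by simp
  have "\<exists>xs. ham_cycle G xs" if HeqG: "verts H = verts G"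
  proof (cases "adjacent G (x 0) (x k)")
    case True
    then show ?thesis
      using ham_path_imp_ham_cycle path adjacent_sym G(3) HeqG by metis
  next
    case False
    let ?A = "verts (P 0) - {x 1}" and ?B = "verts G - verts (P 0)"
    \<comment> \<open>An edge of \<open>G\<close> outside \<open>H\<close> could only join
      \<open>x 0\<close> and \<open>x k\<close>, which are not adjacent here. So the edge lies in
      some part, not the first because of \<open>v\<close>; but then \<open>u\<close> is shared by
      that part and the first, which forces it to be \<open>x 1\<close>.\<close>
    have cross: False if uv: "u \<in> ?A" "v \<in> ?B" "adjacent G u v" for u v
    proof -
      obtain e where e: "e \<in> edges G" "ends G e = {u, v}" using uv(3) by (auto simp: adjacent_def)
      have "x k \<notin> verts (P 0)"
      proof (cases "k = 2")
        case True
        then show ?thesis using x2(2) by simp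
      next
        case False
        then have "verts (P 0) \<inter> verts (P (k - 1)) = {}" using disj[of 0 "k - 1"] k by simp
        then show ?thesis using xk by blast
      qed
      then have "\<not> (u \<in> {x 0, x k} \<and> v \<in> {x 0, x k})"
        using uv False xP(1)[OF k0(1)] by auto
      then have "ends G e \<inter> (verts H - {x 0, x k}) \<noteq> {}"
        using e(2) uv HeqG PG[OF k0(1)] by auto
      then have "e \<in> edges H" using H e(1) by (auto simp: attached_def)
      then obtain j where j: "j < k" "e \<in> edges (P j)"
        using un by (auto simp: edge_disjoint_union_def)
      then have uvP: "u \<in> verts (P j)" "v \<in> verts (P j)"
        using ends[OF j] att[OF j(1)] e(2) by (auto simp: attached_def)
      then have "j \<noteq> 0" using uv(2) uvP(2) by (metis DiffD2)
      then show False using meet0[OF j(1)] uvP(1) uv(1) by auto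
    qed
    have inG: "v \<in> verts G" if "adjacent G u v" for u v
      using that multigraph.ends_in_verts[OF G(1)] by (force simp: adjacent_def)
    have "x 0 \<in> ?A" using xP(1)[OF k0(1)] xne[OF k0(1)] by simp
    then have "closed_off G {x 1} ?A"
      unfolding closed_off_def using cross inG PG[OF k0(1)] by blast
    moreover have "x 1 \<in> verts (P 0)" using xP(2)[OF k0(1)] by simp
    moreover have "x 2 \<in> ?B" using x2 PG[OF k0(2)] by blast
    moreover have "v \<in> ?B \<union> {x 1}" if "u \<in> ?B" "adjacent G u v" for u v
      using cross[OF _ that(1) adjacent_sym[OF that(2)]] inG[OF that(2)] by blast
    ultimately have "closed_off G {x 1} ?A" "closed_off G {x 1} ?B" "x 1 \<in> verts G"
      using PG[OF k0(1)] by (auto simp: closed_off_def)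
    moreover have "?A \<inter> ?B = {}" by blast
    ultimately show ?thesis
      using tough_1_two_closed[OF finG G(2), of "x 1" ?A ?B] by blast
  qed
  then show ?thesis using path by simp
qed

text \<open>\<open>G\<close> stays fixed while \<open>H\<close> runs through the decomposition; the
  case that \<open>H\<close> is \<open>G\<close> itself gives the Hamiltonian cycle.\<close>

lemma ham_path_or_ham_cycle:
  assumes "series_parallel_terminals H s t"
    and G: "multigraph G" "tough 1 G" "3 \<le> card (verts G)"
    and "attached G H s t"
  shows "if verts H = verts G then \<exists>xs. ham_cycle G xs else ham_path G (verts H) s t"
  using assms(1,5)
proof (induction rule: series_parallel_terminals.induct)
  case (single_edge s t H e)
  have "card (verts H) \<le> 2" by (simp add: single_edge.hyps(2) card_insert_if)
  then have "verts H \<noteq> verts G" using G(3) by auto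
  moreover have "adjacent G s t"
    using single_edge by (auto simp: adjacent_def attached_def)
  ultimately show ?case using ham_path_edge single_edge.hyps by simp
next
  case (series_join k P x H)
  show ?case
    by (rule ham_path_or_ham_cycle_series[OF G series_join.prems series_join.hyps(1,2)
          series_join.IH series_join.hyps(3-5)])
next
  case (parallel_join k P s t H)
  show ?case
    by (rule ham_path_or_ham_cycle_parallel[OF G parallel_join.prems parallel_join.hyps(1,2)
          parallel_join.IH parallel_join.hyps(3,4)])
qed

section \<open>Minimality leaves only the edges of the cycle\<close>

text \<open>With parallel edges the vertex list does not determine the edges traversed, so a choice
  \<open>c\<close> of edges avoiding \<open>e\<close> is given explicitly.\<close>

lemma ham_cycle_del_edge:
  assumes "ham_cycle G xs" "\<And>i. i < length xs \<Longrightarrow> c i \<in> edges G - {e}"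
    and "\<And>i. i < length xs \<Longrightarrow> ends G (c i) = {xs ! i, xs ! (Suc i mod length xs)}"
  shows "ham_cycle (del_edge G e) xs"
proof -
  let ?n = "length xs"
  have n: "3 \<le> ?n" using assms(1) by (simp add: ham_cycle_def)
  have adj: "adjacent (del_edge G e) (xs ! i) (xs ! (Suc i mod ?n))" if "i < ?n" for i
    using assms(2,3)[OF that] by (auto simp: adjacent_def del_edge_def)
  have "successively (adjacent (del_edge G e)) xs"
    unfolding successively_conv_nth using adj by (metis Suc_lessD mod_less)
  moreover have "adjacent (del_edge G e) (last xs) (hd xs)"
  proof -
    have "xs \<noteq> []" using n by auto
    then show ?thesis using adj[of "?n - 1"] by (simp add: last_conv_nth hd_conv_nth)
  qed
  ultimately show ?thesis using assms(1) by (simp add: ham_cycle_def del_edge_def)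
qed

lemma minimally_tough_1_ham_cycle_imp_is_cycle:
  assumes "multigraph G" "minimally_tough 1 G" "ham_cycle G xs"
  shows "is_cycle G"
proof -
  let ?n = "length xs"
  have n: "3 \<le> ?n" "distinct xs" "set xs = verts G" using assms(3) by (auto simp: ham_cycle_def)
  have "\<exists>e. e \<in> edges G \<and> ends G e = {xs ! i, xs ! (Suc i mod ?n)}" if "i < ?n" for i
    using ham_cycle_adjacent_nth[OF assms(3), of i] that by (auto simp: adjacent_def)
  then obtain c where c: "\<And>i. i < ?n \<Longrightarrow> c i \<in> edges G"
    "\<And>i. i < ?n \<Longrightarrow> ends G (c i) = {xs ! i, xs ! (Suc i mod ?n)}"
    by metis
  have "inj_on c {..<?n}"
  proof (rule inj_onI)
    fix i j assume ij: "i \<in> {..<?n}" "j \<in> {..<?n}" "c i = c j"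
    then have "{xs ! i, xs ! (Suc i mod ?n)} = {xs ! j, xs ! (Suc j mod ?n)}"
      using c(2) by (metis lessThan_iff)
    then consider "xs ! i = xs ! j" | "xs ! i = xs ! (Suc j mod ?n)" "xs ! j = xs ! (Suc i mod ?n)"
      by (auto simp: doubleton_eq_iff)
    then show "i = j"
    proof cases
      case 1
      then show ?thesis using ij n(2) by (simp add: nth_eq_iff_index_eq)
    next
      \<comment> \<open>Two positions that are each other's successors exist only on a cycle of
        length at most two.\<close>
      case 2
      have "Suc i mod ?n < ?n" "Suc j mod ?n < ?n" using n(1) by (auto intro!: mod_less_divisor)
      then have "i = Suc j mod ?n" "j = Suc i mod ?n"
        using 2 ij n(2) by (auto simp: nth_eq_iff_index_eq)
      then have "i = 0 \<and> Suc j = ?n \<or> i = Suc j" "j = 0 \<and> Suc i = ?n \<or> j = Suc i"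
        using ij(1,2) mod_Suc[of i ?n] mod_Suc[of j ?n] by (metis lessThan_iff mod_less)+
      then show ?thesis using n(1) by linarith
    qed
  qed
  moreover have "c ` {..<?n} = edges G"
  proof (rule ccontr)
    assume "c ` {..<?n} \<noteq> edges G"
    then obtain e where e: "e \<in> edges G" "e \<notin> c ` {..<?n}" using c(1) by auto
    then have "ham_cycle (del_edge G e) xs"
      using ham_cycle_del_edge[OF assms(3), of c e] c by blast
    moreover have "finite (verts (del_edge G e))"
      using multigraph.finite_verts[OF assms(1)] by (simp add: del_edge_def)
    ultimately have "ereal 1 \<le> toughness (del_edge G e)"
      using ham_cycle_imp_tough_1 tough_imp_toughness_ge by blast
    then show False using e(1) assms(2) by (auto simp: minimally_tough_def)
  qed
  ultimately have "bij_betw c {..<?n} (edges G)" by (simp add: bij_betw_def)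
  moreover have "bij_betw (\<lambda>i. xs ! i) {..<?n} (verts G)"
    using bij_betw_nth[OF n(2)] n(3) by simp
  ultimately show ?thesis unfolding is_cycle_def using n(1) c(2) by blast
qed

theorem theorem3p1:
  fixes G :: "('v, 'e) mgraph"
  assumes "multigraph G"
    and "series_parallel G"
    and "minimally_tough 1 G"
  shows "is_cycle G"
proof -
  obtain s t where sp: "series_parallel_terminals G s t"
    using assms(2) by (auto simp: series_parallel_def)
  have tau: "toughness G = ereal 1" using assms(3) by (simp add: minimally_tough_def)
  have "3 \<le> card (verts G)"
    using toughness_1_card_verts[OF multigraph.finite_verts[OF assms(1)] tau] by simp
  moreover have "tough 1 G" using toughness_ge_imp_tough tau by (metis order_refl)
  \<comment> \<open>With nothing of \<open>G\<close> outside \<open>G\<close>, the whole graph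
    counts as a part of itself.\<close>
  moreover have "attached G G s t"
    using multigraph.ends_in_verts[OF assms(1)] by (auto simp: attached_def)
  ultimately obtain xs where "ham_cycle G xs"
    using ham_path_or_ham_cycle[OF sp assms(1)] by auto
  then show ?thesis using minimally_tough_1_ham_cycle_imp_is_cycle assms(1,3) by blast
qed

end
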